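(* Let $\mathcal K$ be a Fraïssé class with Fraïssé limit $\mathbf K$. Then the following are equivalent: (i) there is a dense conjugacy class in $\mathrm{Aut}(\mathbf K)$; (ii) $\mathcal K_p$ satisfies the joint embedding property (JEP).
   Context: Fix a countable first-order signature $L$. A class $\mathcal K$ of finite $L$-structures is a Fraïssé class if: (HP) whenever $\mathbf A$ embeds in $\mathbf B\in\mathcal K$, then $\mathbf A\in\mathcal K$; (JEP) any $\mathbf A,\mathbf B\in\mathcal K$ both embed in some $\mathbf C\in\mathcal K$; (AP) for embeddings $f:\mathbf A\to\mathbf B$, $g:\mathbf A\to\mathbf C$ with $\mathbf A,\mathbf B,\mathbf C\in\mathcal K$ there are $\mathbf D\in\mathcal K$ and embeddings $r:\mathbf B\to\mathbf D$, $s:\mathbf C\to\mathbf D$ with $r\circ f=s\circ g$; and $\mathcal K$ contains only countably many structures up to isomorphism and structures of arbitrarily large finite cardinality. Its Fraïssé limit $\mathbf K$ is the unique (up to isomorphism) countably infinite structure that is locally finite (finitely generated substructures are finite), ultrahomogeneous (any isomorphism between finite substructures extends to an automorphism), and for which $\mathcal K$ is exactly the class of finite structures embeddable in $\mathbf K$. The Polish group $\mathrm{Aut}(\mathbf K)$ carries the pointwise convergence topology ($\mathbf K$ discrete). $\mathcal K_p$ is the class of all systems $\mathcal S=\langle\mathbf A,\psi:\mathbf B\to\mathbf C\rangle$, where $\mathbf A,\mathbf B,\mathbf C\in\mathcal K$, $\mathbf B,\mathbf C\subseteq\mathbf A$ are substructures and $\psi$ is an isomorphism of $\mathbf B$ onto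 $\mathbf C$. An embedding of $\mathcal S$ into $\mathcal T=\langle\mathbf D,\varphi:\mathbf E\to\mathbf F\rangle$ is an embedding $f:\mathbf A\to\mathbf D$ that maps $\mathbf B$ into $\mathbf E$ and $\mathbf C$ into $\mathbf F$ and satisfies $f\circ\psi\subseteq\varphi\circ f$ (i.e. $f(\psi(b))=\varphi(f(b))$ for all $b\in\mathbf B$). $\mathcal K_p$ satisfies JEP if any two systems in $\mathcal K_p$ embed in a common system in $\mathcal K_p$. *)

theory Defs
  imports "HOL-Algebra.Bij" "HOL-Analysis.Function_Topology"
begin

text \<open>Constants are function symbols of arity \<open>0\<close>. The symbols are sets, not whole types, so that a
  signature may lack function symbols or relation symbols.\<close>

record ('f, 'r) signature =
  Funs :: "'f set"
  Rels :: "'r set"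
  farity :: "'f \<Rightarrow> nat"
  rarity :: "'r \<Rightarrow> nat"

definition countable_signature :: "('f, 'r) signature \<Rightarrow> bool" where
  "countable_signature L \<longleftrightarrow> countable (Funs L) \<and> countable (Rels L)"

text \<open>Interpretations are total HOL functions; only their values at symbols of the signature and
  at tuples of the right length over the universe have a meaning.\<close>

record ('f, 'r, 'a) fo_structure =
  univ :: "'a set"
  fint :: "'f \<Rightarrow> 'a list \<Rightarrow> 'a"
  rint :: "'r \<Rightarrow> 'a list \<Rightarrow> bool"

definition tuples :: "'a set \<Rightarrow> nat \<Rightarrow> 'a list set" where
  "tuples S n = {xs. set xs \<subseteq> S \<and> length xs = n}"

definition closed_subset ::
    "('f, 'r) signature \<Rightarrow> ('f, 'r, 'a) fo_structure \<Rightarrow> 'a set \<Rightarrow> bool" where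
  "closed_subset L M S \<longleftrightarrow>
     S \<subseteq> univ M \<and> (\<forall>f\<in>Funs L. \<forall>xs\<in>tuples S (farity L f). fint M f xs \<in> S)"

text \<open>As usual in first-order logic, universes are nonempty.\<close>

definition is_structure :: "('f, 'r) signature \<Rightarrow> ('f, 'r, 'a) fo_structure \<Rightarrow> bool" where
  "is_structure L M \<longleftrightarrow> univ M \<noteq> {} \<and> closed_subset L M (univ M)"

definition finite_structure :: "('f, 'r) signature \<Rightarrow> ('f, 'r, 'a) fo_structure \<Rightarrow> bool" where
  "finite_structure L M \<longleftrightarrow> is_structure L M \<and> finite (univ M)"

definition is_embedding ::
    "('f, 'r) signature \<Rightarrow> ('f, 'r, 'a) fo_structure \<Rightarrow> ('f, 'r, 'b) fo_structure
      \<Rightarrow> ('a \<Rightarrow> 'b) \<Rightarrow> bool" where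
  "is_embedding L M N h \<longleftrightarrow>
     h ` univ M \<subseteq> univ N \<and> inj_on h (univ M) \<and>
     (\<forall>f\<in>Funs L. \<forall>xs\<in>tuples (univ M) (farity L f). h (fint M f xs) = fint N f (map h xs)) \<and>
     (\<forall>R\<in>Rels L. \<forall>xs\<in>tuples (univ M) (rarity L R). rint M R xs \<longleftrightarrow> rint N R (map h xs))"

definition embeds ::
    "('f, 'r) signature \<Rightarrow> ('f, 'r, 'a) fo_structure \<Rightarrow> ('f, 'r, 'b) fo_structure \<Rightarrow> bool" where
  "embeds L M N \<longleftrightarrow> (\<exists>h. is_embedding L M N h)"

definition is_isomorphism ::
    "('f, 'r) signature \<Rightarrow> ('f, 'r, 'a) fo_structure \<Rightarrow> ('f, 'r, 'b) fo_structure
      \<Rightarrow> ('a \<Rightarrow> 'b) \<Rightarrow> bool" where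
  "is_isomorphism L M N h \<longleftrightarrow> is_embedding L M N h \<and> h ` univ M = univ N"

definition isomorphic ::
    "('f, 'r) signature \<Rightarrow> ('f, 'r, 'a) fo_structure \<Rightarrow> ('f, 'r, 'b) fo_structure \<Rightarrow> bool" where
  "isomorphic L M N \<longleftrightarrow> (\<exists>h. is_isomorphism L M N h)"

definition substructure ::
    "('f, 'r) signature \<Rightarrow> ('f, 'r, 'a) fo_structure \<Rightarrow> ('f, 'r, 'a) fo_structure \<Rightarrow> bool" where
  "substructure L B A \<longleftrightarrow>
     is_structure L B \<and> is_structure L A \<and> univ B \<subseteq> univ A \<and>
     (\<forall>f\<in>Funs L. \<forall>xs\<in>tuples (univ B) (farity L f). fint B f xs = fint A f xs) \<and>
     (\<forall>R\<in>Rels L. \<forall>xs\<in>tuples (univ B) (rarity L R). rint B R xs \<longleftrightarrow> rint A R xs)"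

definition HP :: "('f, 'r) signature \<Rightarrow> ('f, 'r, 'a) fo_structure set \<Rightarrow> bool" where
  "HP L \<K> \<longleftrightarrow> (\<forall>A. \<forall>B\<in>\<K>. is_structure L A \<and> embeds L A B \<longrightarrow> A \<in> \<K>)"

definition JEP :: "('f, 'r) signature \<Rightarrow> ('f, 'r, 'a) fo_structure set \<Rightarrow> bool" where
  "JEP L \<K> \<longleftrightarrow> (\<forall>A\<in>\<K>. \<forall>B\<in>\<K>. \<exists>C\<in>\<K>. embeds L A C \<and> embeds L B C)"

definition AP :: "('f, 'r) signature \<Rightarrow> ('f, 'r, 'a) fo_structure set \<Rightarrow> bool" where
  "AP L \<K> \<longleftrightarrow>
     (\<forall>A\<in>\<K>. \<forall>B\<in>\<K>. \<forall>C\<in>\<K>. \<forall>f g. is_embedding L A B f \<and> is_embedding L A C g \<longrightarrow>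
       (\<exists>D\<in>\<K>. \<exists>r s. is_embedding L B D r \<and> is_embedding L C D s \<and>
          (\<forall>a\<in>univ A. r (f a) = s (g a))))"

text \<open>A class of finite structures is given by its members whose universe is a subset of the type
  \<open>'a\<close>. The last conjunct forces \<open>'a\<close> to be infinite, so every finite structure has an isomorphic
  copy over \<open>'a\<close>; \<^const>\<open>HP\<close> makes the class closed under isomorphism.\<close>

definition fraisse_class :: "('f, 'r) signature \<Rightarrow> ('f, 'r, 'a) fo_structure set \<Rightarrow> bool" where
  "fraisse_class L \<K> \<longleftrightarrow>
     (\<forall>A\<in>\<K>. finite_structure L A) \<and> HP L \<K> \<and> JEP L \<K> \<and> AP L \<K> \<and>
     (\<exists>\<C>. countable \<C> \<and> \<C> \<subseteq> \<K> \<and> (\<forall>A\<in>\<K>. \<exists>B\<in>\<C>. isomorphic L A B)) \<and>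
     (\<forall>n. \<exists>A\<in>\<K>. n \<le> card (univ A))"

text \<open>The hull is the smallest closed subset containing \<open>X\<close>, i.e. the universe of the substructure
  generated by \<open>X\<close> (or \<open>{}\<close>, if \<open>X = {}\<close> and there are no constants).\<close>

definition locally_finite :: "('f, 'r) signature \<Rightarrow> ('f, 'r, 'a) fo_structure \<Rightarrow> bool" where
  "locally_finite L M \<longleftrightarrow> (\<forall>X. X \<subseteq> univ M \<and> finite X \<longrightarrow> finite (closed_subset L M hull X))"

definition ultrahomogeneous :: "('f, 'r) signature \<Rightarrow> ('f, 'r, 'a) fo_structure \<Rightarrow> bool" where
  "ultrahomogeneous L M \<longleftrightarrow>
     (\<forall>B C h. substructure L B M \<and> substructure L C M \<and> finite (univ B) \<and> finite (univ C) \<and>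
        is_isomorphism L B C h \<longrightarrow>
        (\<exists>g. is_isomorphism L M M g \<and> (\<forall>b\<in>univ B. g b = h b)))"

definition fraisse_limit ::
    "('f, 'r) signature \<Rightarrow> ('f, 'r, 'a) fo_structure set \<Rightarrow> ('f, 'r, 'k) fo_structure \<Rightarrow> bool" where
  "fraisse_limit L \<K> K \<longleftrightarrow>
     is_structure L K \<and> countable (univ K) \<and> infinite (univ K) \<and>
     locally_finite L K \<and> ultrahomogeneous L K \<and>
     (\<forall>A. A \<in> \<K> \<longleftrightarrow> finite_structure L A \<and> embeds L A K)"

text \<open>Automorphisms are restricted to the universe (\<^const>\<open>extensional\<close>, via \<^const>\<open>Bij\<close>), so that
  two of them are equal as HOL functions iff they agree on the universe.\<close>

definition Aut ::
    "('f, 'r) signature \<Rightarrow> ('f, 'r, 'k) fo_structure \<Rightarrow> ('k \<Rightarrow> 'k) monoid" where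
  "Aut L K = (BijGroup (univ K)) \<lparr>carrier := {g \<in> Bij (univ K). is_isomorphism L K K g}\<rparr>"

definition Aut_topology ::
    "('f, 'r) signature \<Rightarrow> ('f, 'r, 'k) fo_structure \<Rightarrow> ('k \<Rightarrow> 'k) topology" where
  "Aut_topology L K =
     subtopology (product_topology (\<lambda>_. discrete_topology (univ K)) (univ K)) (carrier (Aut L K))"

definition conjugacy_class :: "('g, 'm) monoid_scheme \<Rightarrow> 'g \<Rightarrow> 'g set" where
  "conjugacy_class G g = (\<lambda>h. h \<otimes>\<^bsub>G\<^esub> g \<otimes>\<^bsub>G\<^esub> inv\<^bsub>G\<^esub> h) ` carrier G"

definition has_dense_conjugacy_class ::
    "('f, 'r) signature \<Rightarrow> ('f, 'r, 'k) fo_structure \<Rightarrow> bool" where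
  "has_dense_conjugacy_class L K \<longleftrightarrow>
     (\<exists>g\<in>carrier (Aut L K).
        Aut_topology L K closure_of conjugacy_class (Aut L K) g = topspace (Aut_topology L K))"

text \<open>The system \<open>\<langle>A, \<psi> : B \<rightarrow> C\<rangle>\<close>; only the values of \<open>\<psi>\<close> on the universe of \<open>B\<close> matter.\<close>

record ('f, 'r, 'a) system =
  amb :: "('f, 'r, 'a) fo_structure"
  src :: "('f, 'r, 'a) fo_structure"
  tgt :: "('f, 'r, 'a) fo_structure"
  pmap :: "'a \<Rightarrow> 'a"

definition systems ::
    "('f, 'r) signature \<Rightarrow> ('f, 'r, 'a) fo_structure set \<Rightarrow> ('f, 'r, 'a) system set" where
  "systems L \<K> =
     {S. amb S \<in> \<K> \<and> src S \<in> \<K> \<and> tgt S \<in> \<K> \<and>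
         substructure L (src S) (amb S) \<and> substructure L (tgt S) (amb S) \<and>
         is_isomorphism L (src S) (tgt S) (pmap S)}"

definition system_embedding ::
    "('f, 'r) signature \<Rightarrow> ('f, 'r, 'a) system \<Rightarrow> ('f, 'r, 'a) system \<Rightarrow> ('a \<Rightarrow> 'a) \<Rightarrow> bool" where
  "system_embedding L S T f \<longleftrightarrow>
     is_embedding L (amb S) (amb T) f \<and>
     f ` univ (src S) \<subseteq> univ (src T) \<and> f ` univ (tgt S) \<subseteq> univ (tgt T) \<and>
     (\<forall>b\<in>univ (src S). f (pmap S b) = pmap T (f b))"

definition systems_JEP ::
    "('f, 'r) signature \<Rightarrow> ('f, 'r, 'a) fo_structure set \<Rightarrow> bool" where
  "systems_JEP L \<K> \<longleftrightarrow>
     (\<forall>S\<in>systems L \<K>. \<forall>T\<in>systems L \<K>. \<exists>U\<in>systems L \<K>.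
        (\<exists>f. system_embedding L S U f) \<and> (\<exists>f. system_embedding L T U f))"

end

theory Submission
  imports Defs "HOL-Analysis.Urysohn"
begin

text \<open>The two sides meet in the statement that the conjugation action of \<open>Aut(K)\<close> on itself is
  topologically transitive: a basic neighbourhood of \<open>g\<close> consists of the automorphisms that agree
  with \<open>g\<close> on a finite set, and transitivity says that any two basic neighbourhoods, of \<open>g\<close> and of
  \<open>q\<close>, contain a conjugate pair (\<open>conjugation_transitive\<close>).

  A dense conjugacy class gives this at once. Conversely, \<open>Aut(K)\<close> is a \<open>G\<^sub>\<delta>\<close> subset of the
  Baire space of all functions from the countable universe to itself, hence completely metrizable.
  For a finite partial map \<open>\<Gamma>\<close> with an extension in \<open>Aut(K)\<close>, the automorphisms having a conjugate
  that extends \<open>\<Gamma>\<close> form an open set, which transitivity makes dense. There are countably many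
  \<open>\<Gamma>\<close>, so by the Baire category theorem one automorphism lies in all of these sets, and its
  conjugacy class is dense.

  Transitivity translates into the joint embedding property because systems are the finite pieces
  of the pairs \<open>(K, g)\<close> with \<open>g\<close> in \<open>Aut(K)\<close>. Every system sits inside such a pair
  (\<open>system_realized\<close>): embed its ambient structure and extend its partial isomorphism by
  ultrahomogeneity. Every finite piece of such a pair is a copy of a system
  (\<open>system_of_finite_part\<close>). Given transitivity, two systems are realized in \<open>(K, g)\<close> and
  \<open>(K, q)\<close>; a conjugate pair near \<open>g\<close> and \<open>q\<close> puts both into one pair \<open>(K, c)\<close>, and a
  finite part of \<open>(K, c)\<close> containing both is the joint extension. Given joint embedding, finite
  pieces of \<open>(K, g)\<close> and \<open>(K, q)\<close> embed into one system, this system is realized in some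
  \<open>(K, u)\<close>, and ultrahomogeneity moves the copies inside \<open>(K, u)\<close> onto the original pieces,
  which makes conjugates of \<open>u\<close> agree with \<open>g\<close> and with \<open>q\<close> there.\<close>

section \<open>Embeddings and closed subsets\<close>

lemma tuples_image: "tuples (h ` S) n = map h ` tuples S n"
proof
  show "tuples (h ` S) n \<subseteq> map h ` tuples S n"
  proof
    fix xs assume "xs \<in> tuples (h ` S) n"
    then have "xs \<in> lists (h ` S)" "length xs = n" by (auto simp: tuples_def)
    then obtain ys where "ys \<in> lists S" "xs = map h ys" by (auto simp: lists_image)
    with \<open>length xs = n\<close> show "xs \<in> map h ` tuples S n" by (auto simp: tuples_def)
  qed
qed (fastforce simp: tuples_def)

lemma tuples_mono: "S \<subseteq> T \<Longrightarrow> tuples S n \<subseteq> tuples T n"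
  by (auto simp: tuples_def)

lemma structure_fint_in:
  "is_structure L M \<Longrightarrow> f \<in> Funs L \<Longrightarrow> xs \<in> tuples (univ M) (farity L f) \<Longrightarrow> fint M f xs \<in> univ M"
  by (auto simp: is_structure_def closed_subset_def)

lemma embedding_cong:
  assumes "is_structure L M" "is_embedding L M N h" "\<And>x. x \<in> univ M \<Longrightarrow> h' x = h x"
  shows "is_embedding L M N h'"
proof -
  have map: "map h' xs = map h xs" if "xs \<in> tuples (univ M) n" for xs n
    using that assms(3) by (auto simp: tuples_def)
  have "h' ` univ M = h ` univ M" using assms(3) by (rule image_cong[OF refl])
  moreover have "inj_on h' (univ M) \<longleftrightarrow> inj_on h (univ M)" using assms(3) by (rule inj_on_cong)
  ultimately show ?thesis
    using assms(2) by (auto simp: is_embedding_def map assms(3) structure_fint_in[OF assms(1)])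
qed

lemma isomorphism_cong:
  assumes "is_structure L M" "is_isomorphism L M N h" "\<And>x. x \<in> univ M \<Longrightarrow> h' x = h x"
  shows "is_isomorphism L M N h'"
  using assms embedding_cong[of L M N h h'] image_cong[of "univ M" "univ M" h' h]
  by (auto simp: is_isomorphism_def)

lemma embedding_comp:
  assumes "is_embedding L M N h" "is_embedding L N P k"
  shows "is_embedding L M P (k \<circ> h)"
proof -
  have t: "map h xs \<in> tuples (univ N) n" if "xs \<in> tuples (univ M) n" for xs n
    using that assms(1) by (fastforce simp: tuples_def is_embedding_def)
  have "inj_on (k \<circ> h) (univ M)"
    using assms by (auto simp: is_embedding_def intro: comp_inj_on inj_on_subset)
  then show ?thesis
    using assms t by (fastforce simp: is_embedding_def)
qed

lemma isomorphism_comp: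
  assumes "is_isomorphism L M N h" "is_isomorphism L N P k"
  shows "is_isomorphism L M P (k \<circ> h)"
proof -
  have "(k \<circ> h) ` univ M = k ` h ` univ M" by (simp add: image_comp)
  then show ?thesis
    using assms embedding_comp[of L M N h P k] by (simp add: is_isomorphism_def)
qed

lemma isomorphism_inverse:
  assumes "is_structure L M" "is_isomorphism L M N h"
  shows "is_isomorphism L N M (inv_into (univ M) h)"
proof -
  let ?i = "inv_into (univ M) h"
  have inj: "inj_on h (univ M)" and im: "h ` univ M = univ N" and emb: "is_embedding L M N h"
    using assms(2) by (auto simp: is_isomorphism_def is_embedding_def)
  have t: "\<exists>ys\<in>tuples (univ M) n. xs = map h ys \<and> map ?i xs = ys"
    if "xs \<in> tuples (univ N) n" for xs n
  proof -
    from that im obtain ys where ys: "ys \<in> tuples (univ M) n" "xs = map h ys"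
      using tuples_image[of h "univ M" n] by auto
    then have "map ?i xs = ys"
      using inj by (auto simp: tuples_def intro!: map_idI)
    with ys show ?thesis by blast
  qed
  have "?i (fint N f xs) = fint M f (map ?i xs)"
    if f: "f \<in> Funs L" "xs \<in> tuples (univ N) (farity L f)" for f xs
  proof -
    from t[OF f(2)] obtain ys where ys: "ys \<in> tuples (univ M) (farity L f)" "xs = map h ys"
      "map ?i xs = ys" by blast
    have "fint N f xs = h (fint M f ys)"
      using emb f(1) ys by (simp add: is_embedding_def)
    then show ?thesis
      using inj ys structure_fint_in[OF assms(1) f(1) ys(1)] by simp
  qed
  moreover have "rint N R xs \<longleftrightarrow> rint M R (map ?i xs)"
    if "R \<in> Rels L" "xs \<in> tuples (univ N) (rarity L R)" for R xs
    using t[OF that(2)] emb that(1) by (auto simp: is_embedding_def)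
  ultimately show ?thesis
    using im inj inj_on_inv_into[of "univ N" h "univ M"] inv_into_image_cancel[OF inj, of "univ M"]
    by (auto simp: is_isomorphism_def is_embedding_def)
qed

text \<open>The substructure of \<open>M\<close> on a closed set \<open>S\<close> is written \<open>M\<lparr>univ := S\<rparr>\<close>. It shares the total
  interpretation functions of \<open>M\<close>, so an embedding of \<open>M\<close> is an embedding of each of these
  without any change.\<close>

lemma substructure_of_closed_subset:
  assumes "is_structure L M" "closed_subset L M S" "S \<noteq> {}"
  shows "substructure L (M\<lparr>univ := S\<rparr>) M"
  using assms by (auto simp: substructure_def is_structure_def closed_subset_def)

lemma embedding_restrict:
  assumes "is_embedding L M N h" "S \<subseteq> univ M"
  shows "is_isomorphism L (M\<lparr>univ := S\<rparr>) (N\<lparr>univ := h ` S\<rparr>) h"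
  using assms tuples_mono[OF assms(2)] inj_on_subset[OF _ assms(2)]
  by (auto simp: is_isomorphism_def is_embedding_def subset_iff)

lemma embedding_extend_codomain:
  "is_embedding L M (N\<lparr>univ := D\<rparr>) h \<Longrightarrow> D \<subseteq> univ N \<Longrightarrow> is_embedding L M N h"
  by (auto simp: is_embedding_def)

lemma closed_subset_image:
  assumes "is_embedding L M N h" "closed_subset L M S"
  shows "closed_subset L N (h ` S)"
proof -
  have S: "S \<subseteq> univ M" using assms(2) by (simp add: closed_subset_def)
  have "fint N f xs \<in> h ` S" if f: "f \<in> Funs L" "xs \<in> tuples (h ` S) (farity L f)" for f xs
  proof -
    from f(2) obtain ys where ys: "ys \<in> tuples S (farity L f)" "xs = map h ys"
      by (auto simp: tuples_image)
    then have "fint N f xs = h (fint M f ys)"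
      using assms(1) f(1) subsetD[OF tuples_mono[OF S] ys(1)] by (simp add: is_embedding_def)
    then show ?thesis
      using assms(2) f(1) ys(1) by (auto simp: closed_subset_def)
  qed
  moreover have "h ` S \<subseteq> univ N"
    using image_mono[OF S, of h] assms(1) by (auto simp: is_embedding_def)
  ultimately show ?thesis by (simp add: closed_subset_def)
qed

lemma closed_subset_hull:
  assumes "is_structure L M" "X \<subseteq> univ M"
  shows "closed_subset L M (closed_subset L M hull X)"
proof -
  define \<H> where "\<H> = {T. closed_subset L M T \<and> X \<subseteq> T}"
  have "univ M \<in> \<H>" using assms by (simp add: \<H>_def is_structure_def)
  then have "\<Inter>\<H> \<subseteq> univ M" by blast
  moreover have "fint M f xs \<in> \<Inter>\<H>" if f: "f \<in> Funs L" "xs \<in> tuples (\<Inter>\<H>) (farity L f)" for f xs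
  proof
    fix T assume T: "T \<in> \<H>"
    then have "xs \<in> tuples T (farity L f)" using f(2) by (auto simp: tuples_def)
    then show "fint M f xs \<in> T" using T f(1) by (auto simp: closed_subset_def \<H>_def)
  qed
  ultimately have "closed_subset L M (\<Inter>\<H>)" by (simp add: closed_subset_def)
  then show ?thesis by (simp add: hull_def \<H>_def)
qed

lemma finite_closed_superset:
  assumes "is_structure L M" "locally_finite L M" "finite X" "X \<subseteq> univ M"
  obtains E where "X \<subseteq> E" "finite E" "E \<noteq> {}" "closed_subset L M E"
proof -
  \<comment> \<open>The added point keeps the hull nonempty when \<open>X\<close> is empty and there are no constants.\<close>
  obtain x where x: "x \<in> univ M" using assms(1) by (auto simp: is_structure_def)
  let ?E = "closed_subset L M hull (insert x X)"
  have "insert x X \<subseteq> ?E" by (rule hull_subset)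
  moreover have "finite ?E" using assms x by (auto simp: locally_finite_def)
  moreover have "closed_subset L M ?E" using assms x by (intro closed_subset_hull) auto
  ultimately show ?thesis using that[of ?E] by blast
qed

definition transport ::
    "('a \<Rightarrow> 'b) \<Rightarrow> ('f, 'r, 'a) fo_structure \<Rightarrow> ('f, 'r, 'b) fo_structure" where
  "transport j M =
     \<lparr>univ = j ` univ M,
      fint = \<lambda>f xs. j (fint M f (map (inv_into (univ M) j) xs)),
      rint = \<lambda>R xs. rint M R (map (inv_into (univ M) j) xs)\<rparr>"

lemma transport_isomorphism:
  assumes "inj_on j (univ M)"
  shows "is_isomorphism L M (transport j M) j"
proof -
  have "map (inv_into (univ M) j \<circ> j) xs = xs" if "xs \<in> tuples (univ M) n" for xs n
    using that assms by (auto simp: tuples_def intro!: map_idI)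
  then show ?thesis
    using assms by (simp add: is_isomorphism_def is_embedding_def transport_def)
qed

lemma isomorphic_image_structure:
  assumes "is_structure L M" "is_isomorphism L M N h"
  shows "is_structure L N"
  using assms closed_subset_image[of L M N h "univ M"]
  by (auto simp: is_structure_def is_isomorphism_def)

section \<open>The automorphism group\<close>

lemma Aut_carrier: "g \<in> carrier (Aut L K) \<longleftrightarrow> g \<in> Bij (univ K) \<and> is_isomorphism L K K g"
  by (simp add: Aut_def)

lemma Aut_restrict:
  assumes "is_structure L K" "is_isomorphism L K K g"
  shows "restrict g (univ K) \<in> carrier (Aut L K)"
proof -
  have "is_isomorphism L K K (restrict g (univ K))"
    using assms by (rule isomorphism_cong) simp
  then show ?thesis
    by (auto simp: Aut_carrier Bij_def bij_betw_def is_isomorphism_def is_embedding_def)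
qed

lemma Aut_closed: "g \<in> carrier (Aut L K) \<Longrightarrow> x \<in> univ K \<Longrightarrow> g x \<in> univ K"
  by (auto simp: Aut_carrier Bij_def bij_betw_def)

lemma Aut_embedding: "g \<in> carrier (Aut L K) \<Longrightarrow> is_embedding L K K g"
  by (simp add: Aut_carrier is_isomorphism_def)

lemma Aut_subgroup:
  assumes "is_structure L K"
  shows "subgroup (carrier (Aut L K)) (BijGroup (univ K))"
proof (rule group.subgroupI[OF group_BijGroup])
  show "carrier (Aut L K) \<subseteq> carrier (BijGroup (univ K))"
    by (auto simp: Aut_carrier BijGroup_def)
  have "is_isomorphism L K K id"
    by (auto simp: is_isomorphism_def is_embedding_def)
  then show "carrier (Aut L K) \<noteq> {}"
    using Aut_restrict[OF assms] by blast
next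
  fix g assume g: "g \<in> carrier (Aut L K)"
  then have "is_isomorphism L K K (inv_into (univ K) g)"
    using assms isomorphism_inverse by (auto simp: Aut_carrier)
  then show "inv\<^bsub>BijGroup (univ K)\<^esub> g \<in> carrier (Aut L K)"
    using Aut_restrict[OF assms] g by (simp add: inv_BijGroup Aut_carrier)
next
  fix g h assume gh: "g \<in> carrier (Aut L K)" "h \<in> carrier (Aut L K)"
  then have "is_isomorphism L K K (g \<circ> h)"
    using isomorphism_comp by (auto simp: Aut_carrier)
  then have "restrict (g \<circ> h) (univ K) \<in> carrier (Aut L K)"
    using Aut_restrict[OF assms] by blast
  then show "g \<otimes>\<^bsub>BijGroup (univ K)\<^esub> h \<in> carrier (Aut L K)"
    using gh by (simp add: BijGroup_def Aut_carrier compose_def comp_def)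
qed

lemma Aut_group:
  assumes "is_structure L K"
  shows "group (Aut L K)"
  using group.subgroup_imp_group[OF group_BijGroup Aut_subgroup[OF assms]]
  by (simp add: Aut_def)

lemma Aut_mult_apply:
  assumes "g \<in> carrier (Aut L K)" "h \<in> carrier (Aut L K)" "x \<in> univ K"
  shows "(g \<otimes>\<^bsub>Aut L K\<^esub> h) x = g (h x)"
  using assms by (simp add: Aut_def BijGroup_def compose_def)

lemma Aut_inv_apply:
  assumes "is_structure L K" "g \<in> carrier (Aut L K)" "x \<in> univ K"
  shows "(inv\<^bsub>Aut L K\<^esub> g) (g x) = x" "g ((inv\<^bsub>Aut L K\<^esub> g) x) = x"
proof -
  interpret group "Aut L K" by (rule Aut_group[OF assms(1)])
  have one: "\<one>\<^bsub>Aut L K\<^esub> x = x" using assms(3) by (simp add: Aut_def BijGroup_def)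
  show "(inv\<^bsub>Aut L K\<^esub> g) (g x) = x" "g ((inv\<^bsub>Aut L K\<^esub> g) x) = x"
    using assms one l_inv[of g] r_inv[of g]
      Aut_mult_apply[of "inv\<^bsub>Aut L K\<^esub> g" L K g x] Aut_mult_apply[of g L K "inv\<^bsub>Aut L K\<^esub> g" x]
    by simp_all
qed

section \<open>The topology of pointwise convergence\<close>

lemma openin_pointwise:
  fixes U :: "'k set"
  defines "P \<equiv> product_topology (\<lambda>_. discrete_topology U) U"
  assumes S: "S \<subseteq> U \<rightarrow>\<^sub>E U"
  shows "openin (subtopology P S) V \<longleftrightarrow>
    V \<subseteq> S \<and> (\<forall>g\<in>V. \<exists>X. finite X \<and> X \<subseteq> U \<and> (\<forall>h\<in>S. (\<forall>x\<in>X. h x = g x) \<longrightarrow> h \<in> V))"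
    (is "_ \<longleftrightarrow> ?R")
proof
  assume "openin (subtopology P S) V"
  then obtain W where W: "openin P W" "V = W \<inter> S" by (auto simp: openin_subtopology)
  have "\<exists>X. finite X \<and> X \<subseteq> U \<and> (\<forall>h\<in>S. (\<forall>x\<in>X. h x = g x) \<longrightarrow> h \<in> V)" if "g \<in> V" for g
  proof -
    from that W have "g \<in> W" by simp
    with W(1) obtain B where B: "finite {i \<in> U. B i \<noteq> U}" "g \<in> Pi\<^sub>E U B" "Pi\<^sub>E U B \<subseteq> W"
      unfolding P_def openin_product_topology_alt by auto
    have "h \<in> V" if h: "h \<in> S" "\<forall>x\<in>{i \<in> U. B i \<noteq> U}. h x = g x" for h
    proof -
      have "h \<in> U \<rightarrow>\<^sub>E U" using h(1) S by auto
      moreover have "h i \<in> B i" if "i \<in> U" for i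
        using that h(2) B(2) \<open>h \<in> U \<rightarrow>\<^sub>E U\<close> by (cases "B i = U") (auto simp: PiE_iff)
      ultimately have "h \<in> Pi\<^sub>E U B" by (simp add: PiE_iff)
      then show ?thesis using B(3) W h(1) by auto
    qed
    then show ?thesis using B(1) by (intro exI[of _ "{i \<in> U. B i \<noteq> U}"]) auto
  qed
  then show ?R using W by auto
next
  assume R: ?R
  show "openin (subtopology P S) V"
  proof (subst openin_subopen, intro ballI)
    fix g assume g: "g \<in> V"
    with R obtain X where X: "finite X" "X \<subseteq> U" "\<forall>h\<in>S. (\<forall>x\<in>X. h x = g x) \<longrightarrow> h \<in> V" by blast
    have gP: "g \<in> U \<rightarrow>\<^sub>E U" using g R S by auto
    let ?B = "\<lambda>x. if x \<in> X then {g x} else U"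
    have "openin P (Pi\<^sub>E U ?B)"
      unfolding P_def
    proof (rule product_topology_basis)
      show "openin (discrete_topology U) (?B i)" for i using gP X(2) by auto
      show "finite {i. ?B i \<noteq> topspace (discrete_topology U)}"
        using X(1) by (rule finite_subset[rotated]) auto
    qed
    then have "openin (subtopology P S) (Pi\<^sub>E U ?B \<inter> S)" by (auto simp: openin_subtopology)
    moreover have "g \<in> Pi\<^sub>E U ?B \<inter> S" using g R gP by (auto simp: PiE_iff)
    moreover have "Pi\<^sub>E U ?B \<inter> S \<subseteq> V" using X(2,3) by (fastforce simp: PiE_iff)
    ultimately show "\<exists>T. openin (subtopology P S) T \<and> g \<in> T \<and> T \<subseteq> V" by blast
  qed
qed

lemma Aut_subset: "carrier (Aut L K) \<subseteq> univ K \<rightarrow>\<^sub>E univ K"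
  by (auto simp: Aut_carrier PiE_def dest: Bij_imp_extensional Bij_imp_funcset[THEN funcset_mem])

lemmas openin_Aut = openin_pointwise[OF Aut_subset[of L K], folded Aut_topology_def] for L K

lemma topspace_Aut: "topspace (Aut_topology L K) = carrier (Aut L K)"
  using Aut_subset[of L K] by (auto simp: Aut_topology_def)

lemma dense_in_Aut:
  "Aut_topology L K closure_of D = topspace (Aut_topology L K) \<longleftrightarrow>
     (\<forall>g\<in>carrier (Aut L K). \<forall>X. finite X \<and> X \<subseteq> univ K \<longrightarrow>
        (\<exists>d\<in>D \<inter> carrier (Aut L K). \<forall>x\<in>X. d x = g x))"
    (is "?L \<longleftrightarrow> ?R")
proof
  assume dense: ?L
  show ?R
  proof (intro ballI allI impI)
    fix g X assume g: "g \<in> carrier (Aut L K)" and X: "finite X \<and> X \<subseteq> univ K"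
    define V where "V = {h \<in> carrier (Aut L K). \<forall>x\<in>X. h x = g x}"
    have "openin (Aut_topology L K) V"
      unfolding openin_Aut using X by (auto simp: V_def intro!: exI[of _ X])
    moreover have "g \<in> V" using g by (simp add: V_def)
    moreover have "g \<in> Aut_topology L K closure_of D" using dense g by (simp add: topspace_Aut)
    ultimately have "\<exists>d. d \<in> D \<and> d \<in> V" by (simp only: in_closure_of)
    then show "\<exists>d\<in>D \<inter> carrier (Aut L K). \<forall>x\<in>X. d x = g x" by (auto simp: V_def)
  qed
next
  assume R: ?R
  have "g \<in> Aut_topology L K closure_of D" if g: "g \<in> carrier (Aut L K)" for g
    unfolding in_closure_of
  proof (intro conjI allI impI)
    show "g \<in> topspace (Aut_topology L K)" using g by (simp add: topspace_Aut)
    fix T assume T: "g \<in> T \<and> openin (Aut_topology L K) T"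
    then obtain X where "finite X" "X \<subseteq> univ K"
      "\<forall>h\<in>carrier (Aut L K). (\<forall>x\<in>X. h x = g x) \<longrightarrow> h \<in> T" unfolding openin_Aut by blast
    moreover from this R g obtain d where "d \<in> D \<inter> carrier (Aut L K)" "\<forall>x\<in>X. d x = g x" by blast
    ultimately show "\<exists>y. y \<in> D \<and> y \<in> T" by blast
  qed
  then show ?L using closure_of_subset_topspace by (fastforce simp: topspace_Aut)
qed

text \<open>Being an embedding is a closed condition, since a violation involves only finitely many
  values. Being onto is a countable intersection of the open conditions that a given point is
  attained.\<close>

lemma Aut_completely_metrizable:
  assumes "is_structure L K" "countable (univ K)"
  shows "completely_metrizable_space (Aut_topology L K)"
proof -
  let ?U = "univ K"
  define P where "P = product_topology (\<lambda>_. discrete_topology ?U) ?U"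
  have topP: "topspace P = ?U \<rightarrow>\<^sub>E ?U" by (simp add: P_def)
  have openP: "openin P V \<longleftrightarrow> V \<subseteq> ?U \<rightarrow>\<^sub>E ?U \<and>
      (\<forall>g\<in>V. \<exists>X. finite X \<and> X \<subseteq> ?U \<and> (\<forall>h\<in>?U \<rightarrow>\<^sub>E ?U. (\<forall>x\<in>X. h x = g x) \<longrightarrow> h \<in> V))" for V
    using openin_pointwise[of "?U \<rightarrow>\<^sub>E ?U" ?U V] subtopology_topspace[of P]
    by (simp add: P_def)
  have "countable {i \<in> ?U. \<not> (\<exists>a. topspace (discrete_topology ?U) \<subseteq> {a})}"
    using assms(2) by (rule countable_subset[rotated]) auto
  then have cmP: "completely_metrizable_space P"
    unfolding P_def completely_metrizable_space_product_topology
    using completely_metrizable_space_discrete_topology by blast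
  define E where "E = {g \<in> ?U \<rightarrow>\<^sub>E ?U. is_embedding L K K g}"
  have "openin P (topspace P - E)"
    unfolding openP
  proof (intro conjI ballI)
    show "topspace P - E \<subseteq> ?U \<rightarrow>\<^sub>E ?U" by (simp add: topP)
    fix g assume "g \<in> topspace P - E"
    then have g: "g \<in> ?U \<rightarrow>\<^sub>E ?U" "\<not> is_embedding L K K g" by (auto simp: topP E_def)
    have "\<exists>X. finite X \<and> X \<subseteq> ?U \<and> (\<forall>h. (\<forall>x\<in>X. h x = g x) \<longrightarrow> \<not> is_embedding L K K h)"
    proof -
      have "g ` ?U \<subseteq> ?U" using g(1) by auto
      with g(2) consider (not_inj) x y where "x \<in> ?U" "y \<in> ?U" "x \<noteq> y" "g x = g y"
        | (func) f xs where "f \<in> Funs L" "xs \<in> tuples ?U (farity L f)"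
            "g (fint K f xs) \<noteq> fint K f (map g xs)"
        | (rel) R xs where "R \<in> Rels L" "xs \<in> tuples ?U (rarity L R)"
            "rint K R xs \<noteq> rint K R (map g xs)"
        by (auto simp: is_embedding_def inj_on_def) metis+
      then show ?thesis
      proof cases
        case not_inj
        then show ?thesis
          by (intro exI[of _ "{x, y}"]) (auto simp: is_embedding_def inj_on_def)
      next
        case func
        have "\<not> is_embedding L K K h" if "\<forall>x\<in>insert (fint K f xs) (set xs). h x = g x" for h
        proof -
          have "map h xs = map g xs" using that by simp
          then show ?thesis using func that unfolding is_embedding_def by (metis insertI1)
        qed
        then show ?thesis
          using func structure_fint_in[OF assms(1) func(1,2)]
          by (intro exI[of _ "insert (fint K f xs) (set xs)"]) (auto simp: tuples_def)
      next
        case rel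
        have "\<not> is_embedding L K K h" if "\<forall>x\<in>set xs. h x = g x" for h
        proof -
          have "map h xs = map g xs" using that by simp
          then show ?thesis using rel unfolding is_embedding_def by metis
        qed
        then show ?thesis
          using rel by (intro exI[of _ "set xs"]) (auto simp: tuples_def)
      qed
    qed
    moreover have "h \<in> topspace P - E" if "h \<in> ?U \<rightarrow>\<^sub>E ?U" "\<not> is_embedding L K K h" for h
      using that by (simp add: topP E_def)
    ultimately show "\<exists>X. finite X \<and> X \<subseteq> ?U \<and>
        (\<forall>h\<in>?U \<rightarrow>\<^sub>E ?U. (\<forall>x\<in>X. h x = g x) \<longrightarrow> h \<in> topspace P - E)"
      by meson
  qed
  moreover have "E \<subseteq> topspace P" by (auto simp: topP E_def)
  ultimately have "closedin P E" by (simp add: closedin_def)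
  then have gE: "gdelta_in P E"
    using cmP by (intro closed_imp_gdelta_in completely_metrizable_imp_metrizable_space)
  define W where "W y = {g \<in> ?U \<rightarrow>\<^sub>E ?U. y \<in> g ` ?U}" for y
  have gW: "gdelta_in P (W y)" for y
  proof (rule open_imp_gdelta_in)
    have "\<exists>X. finite X \<and> X \<subseteq> ?U \<and> (\<forall>h\<in>?U \<rightarrow>\<^sub>E ?U. (\<forall>x\<in>X. h x = g x) \<longrightarrow> h \<in> W y)"
      if "g \<in> W y" for g
    proof -
      from that obtain x where "x \<in> ?U" "y = g x" by (auto simp: W_def)
      then show ?thesis by (intro exI[of _ "{x}"]) (auto simp: W_def intro!: rev_image_eqI[of x])
    qed
    then show "openin P (W y)" unfolding openP by (auto simp: W_def)
  qed
  have "gdelta_in P (\<Inter>(insert E (W ` ?U)))"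
    using gE gW assms(2) by (intro gdelta_in_Inter) auto
  moreover have "\<Inter>(insert E (W ` ?U)) = carrier (Aut L K)"
  proof (intro equalityI subsetI)
    fix g assume "g \<in> \<Inter>(insert E (W ` ?U))"
    then have g: "g \<in> ?U \<rightarrow>\<^sub>E ?U" "is_embedding L K K g" "?U \<subseteq> g ` ?U"
      by (auto simp: E_def W_def)
    then have "g ` ?U = ?U" "inj_on g ?U" by (auto simp: is_embedding_def)
    with g show "g \<in> carrier (Aut L K)"
      by (simp add: Aut_carrier Bij_def bij_betw_def is_isomorphism_def PiE_def)
  next
    fix g assume "g \<in> carrier (Aut L K)"
    then have "g \<in> ?U \<rightarrow>\<^sub>E ?U" "is_embedding L K K g" "g ` ?U = ?U"
      using Aut_subset[of L K] by (auto simp: Aut_carrier is_isomorphism_def)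
    then show "g \<in> \<Inter>(insert E (W ` ?U))" by (simp add: E_def W_def)
  qed
  ultimately show ?thesis
    using completely_metrizable_space_gdelta_in[OF cmP] by (simp add: Aut_topology_def P_def)
qed

section \<open>Dense conjugacy classes and transitivity of conjugation\<close>

text \<open>The condition \<open>h (q y) = c (h y)\<close> says that \<open>h\<inverse> c h\<close> agrees with \<open>q\<close> at \<open>y\<close>, so \<open>c\<close>
  and \<open>h\<inverse> c h\<close> are the conjugate pair near \<open>g\<close> and \<open>q\<close>.\<close>

definition conjugation_transitive ::
    "('f, 'r) signature \<Rightarrow> ('f, 'r, 'k) fo_structure \<Rightarrow> bool" where
  "conjugation_transitive L K \<longleftrightarrow>
     (\<forall>g\<in>carrier (Aut L K). \<forall>q\<in>carrier (Aut L K). \<forall>X Y.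
        finite X \<and> X \<subseteq> univ K \<and> finite Y \<and> Y \<subseteq> univ K \<longrightarrow>
        (\<exists>c\<in>carrier (Aut L K). \<exists>h\<in>carrier (Aut L K).
           (\<forall>x\<in>X. c x = g x) \<and> (\<forall>y\<in>Y. h (q y) = c (h y))))"

lemma conjugation_transitiveE:
  assumes "conjugation_transitive L K" "g \<in> carrier (Aut L K)" "q \<in> carrier (Aut L K)"
    "finite X" "X \<subseteq> univ K" "finite Y" "Y \<subseteq> univ K"
  obtains c h where "c \<in> carrier (Aut L K)" "\<forall>x\<in>X. c x = g x"
    "h \<in> carrier (Aut L K)" "\<forall>y\<in>Y. h (q y) = c (h y)"
  using assms(1)[unfolded conjugation_transitive_def, rule_format, OF assms(2,3), of X Y]
    assms(4-) that by blast

lemma dense_class_imp_transitive: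
  assumes K: "is_structure L K" and dense: "has_dense_conjugacy_class L K"
  shows "conjugation_transitive L K"
  unfolding conjugation_transitive_def
proof (intro ballI allI impI)
  let ?G = "Aut L K"
  interpret group ?G by (rule Aut_group[OF K])
  fix g q X Y
  assume g: "g \<in> carrier ?G" and q: "q \<in> carrier ?G"
    and XY: "finite X \<and> X \<subseteq> univ K \<and> finite Y \<and> Y \<subseteq> univ K"
  obtain g0 where g0: "g0 \<in> carrier ?G"
    and "Aut_topology L K closure_of conjugacy_class ?G g0 = topspace (Aut_topology L K)"
    using dense by (auto simp: has_dense_conjugacy_class_def)
  then have near: "\<exists>d\<in>conjugacy_class ?G g0. \<forall>x\<in>Z. d x = p x"
    if "p \<in> carrier ?G" "finite Z" "Z \<subseteq> univ K" for p Z
    using that unfolding dense_in_Aut by blast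
  obtain a where a: "a \<in> carrier ?G" "\<forall>x\<in>X. (a \<otimes>\<^bsub>?G\<^esub> g0 \<otimes>\<^bsub>?G\<^esub> inv\<^bsub>?G\<^esub> a) x = g x"
    using near[of g X] g XY by (auto simp: conjugacy_class_def)
  obtain b where b: "b \<in> carrier ?G" "\<forall>y\<in>Y. (b \<otimes>\<^bsub>?G\<^esub> g0 \<otimes>\<^bsub>?G\<^esub> inv\<^bsub>?G\<^esub> b) y = q y"
    using near[of q Y] q XY by (auto simp: conjugacy_class_def)
  \<comment> \<open>Two conjugates of \<open>g0\<close>, by \<open>a\<close> and by \<open>b\<close>, are conjugate to each other by \<open>a b\<inverse>\<close>.\<close>
  let ?c = "a \<otimes>\<^bsub>?G\<^esub> g0 \<otimes>\<^bsub>?G\<^esub> inv\<^bsub>?G\<^esub> a" and ?d = "b \<otimes>\<^bsub>?G\<^esub> g0 \<otimes>\<^bsub>?G\<^esub> inv\<^bsub>?G\<^esub> b"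
    and ?h = "a \<otimes>\<^bsub>?G\<^esub> inv\<^bsub>?G\<^esub> b"
  have "?h \<otimes>\<^bsub>?G\<^esub> ?d = ?c \<otimes>\<^bsub>?G\<^esub> ?h"
    using a(1) b(1) g0 by (simp add: m_assoc inv_solve_left' inv_solve_left)
  then have "?h (q y) = ?c (?h y)" if "y \<in> Y" for y
    using that b XY a(1) g0 Aut_mult_apply[of ?h L K ?d y] Aut_mult_apply[of ?c L K ?h y]
    by auto
  then show "\<exists>c\<in>carrier ?G. \<exists>h\<in>carrier ?G. (\<forall>x\<in>X. c x = g x) \<and> (\<forall>y\<in>Y. h (q y) = c (h y))"
    using a b(1) g0 by (intro bexI[of _ ?c] bexI[of _ ?h]) auto
qed

lemma transitive_imp_dense_class:
  assumes K: "is_structure L K" and count: "countable (univ K)"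
    and trans: "conjugation_transitive L K"
  shows "has_dense_conjugacy_class L K"
proof -
  let ?G = "Aut L K"
  interpret group ?G by (rule Aut_group[OF K])
  define N where "N \<Gamma> = {c \<in> carrier ?G. \<exists>h\<in>carrier ?G. \<forall>(x, y)\<in>\<Gamma>. h y = c (h x)}" for \<Gamma>
  define F where "F = {\<Gamma>. finite \<Gamma> \<and> \<Gamma> \<subseteq> univ K \<times> univ K \<and>
    (\<exists>q\<in>carrier ?G. \<forall>(x, y)\<in>\<Gamma>. q x = y)}"
  have "countable {\<Gamma>. finite \<Gamma> \<and> \<Gamma> \<subseteq> univ K \<times> univ K}"
    using count by (intro countable_Collect_finite_subset countable_SIGMA)
  then have "countable F" by (rule countable_subset[rotated]) (auto simp: F_def)
  then have "countable (N ` F)" by simp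
  moreover have "openin (Aut_topology L K) T \<and>
      Aut_topology L K closure_of T = topspace (Aut_topology L K)" if T: "T \<in> N ` F" for T
  proof
    from T obtain \<Gamma> q where T': "T = N \<Gamma>" and \<Gamma>: "finite \<Gamma>" "\<Gamma> \<subseteq> univ K \<times> univ K"
      and q: "q \<in> carrier ?G" "\<forall>(x, y)\<in>\<Gamma>. q x = y" by (auto simp: F_def)
    show "openin (Aut_topology L K) T"
      unfolding openin_Aut
    proof (intro conjI ballI)
      show "T \<subseteq> carrier ?G" by (auto simp: T' N_def)
      fix c assume "c \<in> T"
      then obtain h where h: "h \<in> carrier ?G" "\<forall>(x, y)\<in>\<Gamma>. h y = c (h x)" by (auto simp: T' N_def)
      have "c' \<in> T" if "c' \<in> carrier ?G" "\<forall>x\<in>h ` fst ` \<Gamma>. c' x = c x" for c'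
      proof -
        have "h y = c' (h x)" if "(x, y) \<in> \<Gamma>" for x y
        proof -
          have "h x \<in> h ` fst ` \<Gamma>" using that by (metis fst_conv imageI)
          then have "c' (h x) = c (h x)" using \<open>\<forall>x\<in>h ` fst ` \<Gamma>. c' x = c x\<close> by blast
          then show ?thesis using h(2) that by auto
        qed
        then show ?thesis using \<open>c' \<in> carrier ?G\<close> h(1) by (auto simp: T' N_def)
      qed
      then show "\<exists>X. finite X \<and> X \<subseteq> univ K \<and> (\<forall>h\<in>carrier ?G. (\<forall>x\<in>X. h x = c x) \<longrightarrow> h \<in> T)"
        using \<Gamma> by (intro exI[of _ "h ` fst ` \<Gamma>"]) (auto intro!: Aut_closed[OF h(1)])
    qed
    show "Aut_topology L K closure_of T = topspace (Aut_topology L K)"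
      unfolding dense_in_Aut
    proof (intro ballI allI impI)
      fix g X assume g: "g \<in> carrier ?G" and X: "finite X \<and> X \<subseteq> univ K"
      have "finite (fst ` \<Gamma>)" "fst ` \<Gamma> \<subseteq> univ K" using \<Gamma> by auto
      then obtain c h where c: "c \<in> carrier ?G" "\<forall>x\<in>X. c x = g x"
        and h: "h \<in> carrier ?G" "\<forall>y\<in>fst ` \<Gamma>. h (q y) = c (h y)"
        by (rule conjugation_transitiveE[OF trans g q(1) conjunct1[OF X] conjunct2[OF X]])
      have "\<forall>(x, y)\<in>\<Gamma>. h y = c (h x)" using h(2) q(2) by force
      then have "c \<in> T" using c(1) h(1) by (auto simp: T' N_def)
      then show "\<exists>d\<in>T \<inter> carrier ?G. \<forall>x\<in>X. d x = g x" using c by blast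
    qed
  qed
  ultimately have "Aut_topology L K closure_of \<Inter>(N ` F) = topspace (Aut_topology L K)"
    using Aut_completely_metrizable[OF K count] by (intro Baire_category) auto
  then have "\<exists>d\<in>\<Inter>(N ` F) \<inter> carrier ?G. \<forall>x\<in>{}. d x = \<one>\<^bsub>?G\<^esub> x"
    unfolding dense_in_Aut using one_closed by blast
  then obtain d where d: "d \<in> carrier ?G" "\<And>\<Gamma>. \<Gamma> \<in> F \<Longrightarrow> d \<in> N \<Gamma>" by blast
  have "Aut_topology L K closure_of conjugacy_class ?G d = topspace (Aut_topology L K)"
    unfolding dense_in_Aut
  proof (intro ballI allI impI)
    fix g X assume g: "g \<in> carrier ?G" and X: "finite X \<and> X \<subseteq> univ K"
    have "(\<lambda>x. (x, g x)) ` X \<in> F"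
      using X g Aut_closed[OF g] by (auto simp: F_def)
    then have "d \<in> N ((\<lambda>x. (x, g x)) ` X)" by (rule d(2))
    then obtain h where h: "h \<in> carrier ?G" "\<forall>x\<in>X. h (g x) = d (h x)"
      by (auto simp: N_def)
    \<comment> \<open>\<open>h\<close> carries \<open>g\<close> to \<open>d\<close>, so it is the inverse of \<open>h\<close> that conjugates \<open>d\<close> back.\<close>
    let ?e = "inv\<^bsub>?G\<^esub> h \<otimes>\<^bsub>?G\<^esub> d \<otimes>\<^bsub>?G\<^esub> inv\<^bsub>?G\<^esub> (inv\<^bsub>?G\<^esub> h)"
    have "?e x = g x" if "x \<in> X" for x
    proof -
      have x: "x \<in> univ K" using that X by auto
      have "?e x = (inv\<^bsub>?G\<^esub> h) (d (h x))"
        using h(1) d(1) x by (simp add: Aut_mult_apply Aut_closed)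
      also have "\<dots> = (inv\<^bsub>?G\<^esub> h) (h (g x))" using h(2) that by simp
      also have "\<dots> = g x" using Aut_inv_apply(1)[OF K h(1)] Aut_closed[OF g x] by simp
      finally show ?thesis .
    qed
    moreover have "?e \<in> conjugacy_class ?G d \<inter> carrier ?G"
      unfolding conjugacy_class_def using h(1) d(1) by (intro IntI imageI) auto
    ultimately show "\<exists>e\<in>conjugacy_class ?G d \<inter> carrier ?G. \<forall>x\<in>X. e x = g x" by blast
  qed
  with d(1) show ?thesis by (auto simp: has_dense_conjugacy_class_def)
qed

section \<open>Systems as finite parts of the limit with an automorphism\<close>

text \<open>An embedding of a system into the pair \<open>(K, g)\<close>, which is not itself a system because \<open>K\<close>
  is infinite.\<close>

definition realizes ::
    "('f, 'r) signature \<Rightarrow> ('f, 'r, 'k) fo_structure \<Rightarrow> ('k \<Rightarrow> 'k) \<Rightarrow> ('f, 'r, 'a) system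
      \<Rightarrow> ('a \<Rightarrow> 'k) \<Rightarrow> bool" where
  "realizes L K g S e \<longleftrightarrow>
     is_embedding L (amb S) K e \<and> (\<forall>b\<in>univ (src S). g (e b) = e (pmap S b))"

lemma ultrahomogeneous_Aut:
  assumes K: "is_structure L K" "ultrahomogeneous L K"
    and M: "finite_structure L M" and e: "is_embedding L M K e" "is_embedding L M K e'"
  obtains a where "a \<in> carrier (Aut L K)" "\<And>x. x \<in> univ M \<Longrightarrow> a (e x) = e' x"
proof -
  have str: "is_structure L M" and fin: "finite (univ M)" and ne: "univ M \<noteq> {}"
    and cl: "closed_subset L M (univ M)"
    using M by (auto simp: finite_structure_def is_structure_def)
  let ?B = "K\<lparr>univ := e ` univ M\<rparr>" and ?C = "K\<lparr>univ := e' ` univ M\<rparr>"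
  have sub: "substructure L ?B K" "substructure L ?C K"
    using ne closed_subset_image[OF e(1) cl] closed_subset_image[OF e(2) cl]
    by (auto intro!: substructure_of_closed_subset[OF K(1)])
  have iso: "is_isomorphism L M ?B e" "is_isomorphism L M ?C e'"
    using embedding_restrict[OF e(1), of "univ M"] embedding_restrict[OF e(2), of "univ M"] by auto
  have "is_isomorphism L ?B ?C (e' \<circ> inv_into (univ M) e)"
    using isomorphism_comp[OF isomorphism_inverse[OF str iso(1)] iso(2)] .
  moreover have "finite (univ ?B)" "finite (univ ?C)" using fin by simp_all
  ultimately obtain a where a: "is_isomorphism L K K a"
      "\<forall>b\<in>univ ?B. a b = (e' \<circ> inv_into (univ M) e) b"
    using K(2) sub unfolding ultrahomogeneous_def by blast
  have inj: "inj_on e (univ M)" and im: "e ` univ M \<subseteq> univ K"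
    using e(1) by (auto simp: is_embedding_def)
  show ?thesis
  proof (rule that[of "restrict a (univ K)"])
    show "restrict a (univ K) \<in> carrier (Aut L K)" by (rule Aut_restrict[OF K(1) a(1)])
    show "restrict a (univ K) (e x) = e' x" if "x \<in> univ M" for x
      using that a(2) im inj by auto
  qed
qed

text \<open>The partial isomorphism of the system, carried into the limit, extends to an automorphism:
  apply ultrahomogeneity to the two embeddings \<open>e\<close> and \<open>e \<circ> \<psi>\<close> of its domain.\<close>

lemma system_realized:
  assumes lim: "fraisse_limit L \<K> K" and S: "S \<in> systems L \<K>"
  obtains g e where "g \<in> carrier (Aut L K)" "realizes L K g S e"
proof -
  have K: "is_structure L K" "ultrahomogeneous L K"
    and mem: "\<And>A. A \<in> \<K> \<longleftrightarrow> finite_structure L A \<and> embeds L A K"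
    using lim by (auto simp: fraisse_limit_def)
  have S': "amb S \<in> \<K>" "src S \<in> \<K>" "substructure L (src S) (amb S)"
    "substructure L (tgt S) (amb S)" "is_isomorphism L (src S) (tgt S) (pmap S)"
    using S by (auto simp: systems_def)
  obtain e where e: "is_embedding L (amb S) K e" using S'(1) mem by (auto simp: embeds_def)
  have incl: "is_embedding L B (amb S) id" if "substructure L B (amb S)" for B
    using that by (auto simp: substructure_def is_embedding_def)
  have "is_embedding L (src S) K (e \<circ> id)"
    by (rule embedding_comp[OF incl[OF S'(3)] e])
  moreover have "is_embedding L (src S) K (e \<circ> id \<circ> pmap S)"
    using embedding_comp[OF _ embedding_comp[OF incl[OF S'(4)] e]] S'(5)
    by (auto simp: is_isomorphism_def)
  moreover have "finite_structure L (src S)" using S'(2) mem by blast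
  ultimately obtain g where "g \<in> carrier (Aut L K)"
      "\<And>x. x \<in> univ (src S) \<Longrightarrow> g ((e \<circ> id) x) = (e \<circ> id \<circ> pmap S) x"
    using ultrahomogeneous_Aut[OF K] by metis
  with e show ?thesis by (intro that[of g e]) (auto simp: realizes_def)
qed

text \<open>The ambient structure is a copy, over the type of the class, of the substructure of the limit
  on \<open>D\<close>; the map \<open>i\<close> is the inverse of the copying map.\<close>

lemma system_of_finite_part:
  fixes \<K> :: "('f, 'r, 'a) fo_structure set"
  assumes lim: "fraisse_limit L \<K> K" and infin: "infinite (UNIV :: 'a set)"
    and g: "g \<in> carrier (Aut L K)"
    and E: "closed_subset L K E" "E \<noteq> {}" and D: "closed_subset L K D" "finite D"
    and sub: "E \<subseteq> D" "g ` E \<subseteq> D"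
  obtains S i where "S \<in> systems L \<K>" "realizes L K g S i" "i ` univ (amb S) = D"
    "i ` univ (src S) = E"
proof -
  have K: "is_structure L K"
    and mem: "\<And>A. A \<in> \<K> \<longleftrightarrow> finite_structure L A \<and> embeds L A K"
    using lim by (auto simp: fraisse_limit_def)
  obtain T :: "'a set" where "finite T" "card T = card D"
    using infinite_arbitrarily_large[OF infin] by blast
  then obtain j where bij: "bij_betw j D T"
    using finite_same_card_bij[of D T] D(2) by metis
  then have j: "inj_on j D" by (simp add: bij_betw_def)
  have DK: "D \<subseteq> univ K" using D(1) by (simp add: closed_subset_def)
  let ?KD = "K\<lparr>univ := D\<rparr>"
  define N where "N = transport j ?KD"
  define i where "i = inv_into D j"
  have univN: "univ N = j ` D" by (simp add: N_def transport_def)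
  have ij: "i (j x) = x" if "x \<in> D" for x using that j by (simp add: i_def)
  have "D \<noteq> {}" using E(2) sub(1) by auto
  then have strD: "is_structure L ?KD"
    using substructure_of_closed_subset[OF K D(1)] by (simp add: substructure_def)
  have isoj: "is_isomorphism L ?KD N j"
    unfolding N_def by (rule transport_isomorphism) (simp add: j)
  then have strN: "is_structure L N" by (rule isomorphic_image_structure[OF strD])
  have embj: "is_embedding L ?KD N j" using isoj by (simp add: is_isomorphism_def)
  have isoi: "is_isomorphism L N ?KD i"
    using isomorphism_inverse[OF strD isoj] by (simp add: i_def)
  then have embi: "is_embedding L N K i"
    using embedding_extend_codomain[OF _ DK] by (auto simp: is_isomorphism_def)
  have part: "N\<lparr>univ := j ` C\<rparr> \<in> \<K> \<and> substructure L (N\<lparr>univ := j ` C\<rparr>) N"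
    if C: "closed_subset L K C" "C \<subseteq> D" "C \<noteq> {}" for C
  proof -
    have "closed_subset L ?KD C" using C by (auto simp: closed_subset_def)
    then have "closed_subset L N (j ` C)" by (rule closed_subset_image[OF embj])
    then have s: "substructure L (N\<lparr>univ := j ` C\<rparr>) N"
      using C(3) by (intro substructure_of_closed_subset[OF strN]) auto
    then have "is_embedding L (N\<lparr>univ := j ` C\<rparr>) N id"
      by (auto simp: substructure_def is_embedding_def)
    then have "embeds L (N\<lparr>univ := j ` C\<rparr>) K"
      using embedding_comp[OF _ embi] by (auto simp: embeds_def)
    moreover have "finite (j ` C)" using D(2) C(2) by (auto intro: finite_subset)
    ultimately show ?thesis using s mem by (simp add: finite_structure_def substructure_def)
  qed
  have gE: "closed_subset L K (g ` E)" by (rule closed_subset_image[OF Aut_embedding[OF g] E(1)])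
  have "N\<lparr>univ := j ` D\<rparr> = N" using univN by (metis fo_structure.surjective fo_structure.update_convs(1))
  then have NK: "N \<in> \<K>" using part[OF D(1)] \<open>D \<noteq> {}\<close> by simp
  define S where "S = \<lparr>amb = N, src = N\<lparr>univ := j ` E\<rparr>, tgt = N\<lparr>univ := j ` g ` E\<rparr>,
    pmap = j \<circ> (g \<circ> i)\<rparr>"
  have iE: "i ` j ` E = E" using ij sub(1) by (force simp: image_image)
  have "is_isomorphism L (N\<lparr>univ := j ` E\<rparr>) (K\<lparr>univ := E\<rparr>) i"
    using embedding_restrict[OF embi, of "j ` E"] sub(1) iE univN by auto
  moreover have "is_isomorphism L (K\<lparr>univ := E\<rparr>) (K\<lparr>univ := g ` E\<rparr>) g"
    using embedding_restrict[OF Aut_embedding[OF g], of E] sub(1) DK by auto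
  moreover have "is_isomorphism L (K\<lparr>univ := g ` E\<rparr>) (N\<lparr>univ := j ` g ` E\<rparr>) j"
    using embedding_restrict[OF embj, of "g ` E"] sub(2) by simp
  ultimately have "is_isomorphism L (N\<lparr>univ := j ` E\<rparr>) (N\<lparr>univ := j ` g ` E\<rparr>) (j \<circ> (g \<circ> i))"
    by (meson isomorphism_comp)
  then have SS: "S \<in> systems L \<K>"
    using NK part[OF E(1) sub(1) E(2)] part[OF gE sub(2)] E(2) by (simp add: systems_def S_def)
  have "i (j b) = b" "i (j (g b)) = g b" if "b \<in> E" for b
    using that sub by (auto intro!: ij)
  then have "realizes L K g S i"
    using embi by (simp add: realizes_def S_def)
  moreover have "i ` univ (amb S) = D" using ij univN by (force simp: S_def image_image)
  moreover have "i ` univ (src S) = E" using iE by (simp add: S_def)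
  ultimately show ?thesis using that SS by blast
qed

text \<open>Inside \<open>(K, g)\<close> the partial map of a realized system is a restriction of \<open>g\<close>. So two systems
  realized in the same pair have compatible partial maps, and inclusion of their images is all that
  an embedding has to respect.\<close>

lemma system_embedding_of_realizations:
  assumes S: "S \<in> systems L \<K>" and U: "U \<in> systems L \<K>"
    and e: "realizes L K g S e" and i: "realizes L K g U i"
    and amb: "e ` univ (amb S) \<subseteq> i ` univ (amb U)" and src: "e ` univ (src S) \<subseteq> i ` univ (src U)"
  shows "system_embedding L S U (inv_into (univ (amb U)) i \<circ> e)"
proof -
  let ?f = "inv_into (univ (amb U)) i \<circ> e"
  have str: "is_structure L (amb U)" and srcU: "univ (src U) \<subseteq> univ (amb U)"
    and isoU: "pmap U ` univ (src U) = univ (tgt U)" and tgtU: "univ (tgt U) \<subseteq> univ (amb U)"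
    using U by (auto simp: systems_def substructure_def is_isomorphism_def)
  have isoS: "pmap S ` univ (src S) = univ (tgt S)"
    using S by (auto simp: systems_def is_isomorphism_def)
  have embe: "is_embedding L (amb S) K e" and embi: "is_embedding L (amb U) K i"
    using e i by (auto simp: realizes_def)
  have inj: "inj_on i (univ (amb U))" using embi by (simp add: is_embedding_def)
  let ?KU = "K\<lparr>univ := i ` univ (amb U)\<rparr>"
  have "is_isomorphism L (amb U) ?KU i"
    using embedding_restrict[OF embi, of "univ (amb U)"] by simp
  then have inv: "is_embedding L ?KU (amb U) (inv_into (univ (amb U)) i)"
    using isomorphism_inverse[OF str, of ?KU i] by (simp add: is_isomorphism_def)
  have "is_embedding L (amb S) ?KU e" using embe amb by (auto simp: is_embedding_def)
  then have emb: "is_embedding L (amb S) (amb U) ?f" using inv by (rule embedding_comp)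
  have key: "?f b \<in> univ (src U) \<and> ?f (pmap S b) = pmap U (?f b)" if b: "b \<in> univ (src S)" for b
  proof -
    obtain u where u: "u \<in> univ (src U)" "e b = i u" using src b by auto
    have fb: "?f b = u" using u srcU inj by auto
    have "e (pmap S b) = g (e b)" using e b by (simp add: realizes_def)
    also have "\<dots> = i (pmap U u)" using i u by (simp add: realizes_def)
    finally have eq: "e (pmap S b) = i (pmap U u)" .
    have "pmap U u \<in> univ (amb U)" using u(1) isoU tgtU by auto
    then have "?f (pmap S b) = pmap U u" using eq inj by simp
    with fb u(1) show ?thesis by simp
  qed
  have "?f ` univ (tgt S) \<subseteq> univ (tgt U)"
    using key isoS isoU by (force simp del: comp_apply)
  with key emb show ?thesis by (auto simp: system_embedding_def simp del: comp_apply)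
qed

section \<open>Transitivity of conjugation and joint embedding of systems\<close>

lemma transitive_imp_JEP:
  fixes \<K> :: "('f, 'r, 'a) fo_structure set"
  assumes lim: "fraisse_limit L \<K> K" and infin: "infinite (UNIV :: 'a set)"
    and trans: "conjugation_transitive L K"
  shows "systems_JEP L \<K>"
  unfolding systems_JEP_def
proof (intro ballI)
  fix S T assume S: "S \<in> systems L \<K>" and T: "T \<in> systems L \<K>"
  have K: "is_structure L K" "locally_finite L K"
    and mem: "\<And>A. A \<in> \<K> \<longleftrightarrow> finite_structure L A \<and> embeds L A K"
    using lim by (auto simp: fraisse_limit_def)
  have fin: "finite (univ (amb R))" "univ (src R) \<subseteq> univ (amb R)" if "R \<in> systems L \<K>" for R
    using that mem by (auto simp: systems_def substructure_def finite_structure_def)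
  obtain g e1 where g: "g \<in> carrier (Aut L K)" and e1: "realizes L K g S e1"
    using system_realized[OF lim S] .
  obtain q e2 where q: "q \<in> carrier (Aut L K)" and e2: "realizes L K q T e2"
    using system_realized[OF lim T] .
  have im: "e1 ` univ (amb S) \<subseteq> univ K" "e2 ` univ (amb T) \<subseteq> univ K"
    using e1 e2 by (auto simp: realizes_def is_embedding_def)
  have "finite (e1 ` univ (src S))" "finite (e2 ` univ (src T))"
    using fin[OF S] fin[OF T] by (auto intro: finite_subset)
  moreover have "e1 ` univ (src S) \<subseteq> univ K" "e2 ` univ (src T) \<subseteq> univ K"
    using im fin(2)[OF S] fin(2)[OF T] by fast+
  ultimately obtain c h where c: "c \<in> carrier (Aut L K)" "\<forall>x\<in>e1 ` univ (src S). c x = g x"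
    and h: "h \<in> carrier (Aut L K)" "\<forall>y\<in>e2 ` univ (src T). h (q y) = c (h y)"
    using conjugation_transitiveE[OF trans g q] by metis
  have r1: "realizes L K c S e1" using e1 c(2) by (auto simp: realizes_def)
  have r2: "realizes L K c T (h \<circ> e2)"
    using e2 h embedding_comp[OF _ Aut_embedding[OF h(1)]] by (auto simp: realizes_def)
  let ?A = "e1 ` univ (amb S) \<union> (h \<circ> e2) ` univ (amb T)"
  have A: "finite ?A" "?A \<subseteq> univ K" using fin[OF S] fin[OF T] im Aut_closed[OF h(1)] by auto
  \<comment> \<open>Since \<open>c\<close> is total, the domain \<open>E\<close> of the joint system may contain both ambient structures
    entirely; this covers the ambient and the distinguished parts at one stroke.\<close>
  obtain E where E: "?A \<subseteq> E" "finite E" "E \<noteq> {}" "closed_subset L K E"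
    by (rule finite_closed_superset[OF K A])
  have EK: "E \<subseteq> univ K" using E(4) by (simp add: closed_subset_def)
  have "finite (E \<union> c ` E)" "E \<union> c ` E \<subseteq> univ K" using E(2) EK Aut_closed[OF c(1)] by auto
  then obtain D where D: "E \<union> c ` E \<subseteq> D" "finite D" "closed_subset L K D"
    by (rule finite_closed_superset[OF K])
  then have "E \<subseteq> D" "c ` E \<subseteq> D" by auto
  then obtain U i where U: "U \<in> systems L \<K>" "realizes L K c U i" "i ` univ (amb U) = D"
      "i ` univ (src U) = E"
    by (rule system_of_finite_part[OF lim infin c(1) E(4,3) D(3,2)])
  have "\<exists>f. system_embedding L R U f"
    if R: "R \<in> systems L \<K>" "realizes L K c R e" "e ` univ (amb R) \<subseteq> E" for R e
  proof -
    have "e ` univ (amb R) \<subseteq> i ` univ (amb U)" using R(3) U(3) D(1) by blast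
    moreover have "e ` univ (src R) \<subseteq> i ` univ (src U)"
      using image_mono[OF fin(2)[OF R(1)], of e] R(3) U(4) by blast
    ultimately show ?thesis using system_embedding_of_realizations[OF R(1) U(1) R(2) U(2)] by blast
  qed
  then have "\<exists>f. system_embedding L S U f" "\<exists>f. system_embedding L T U f"
    using S T r1 r2 E(1) by auto
  then show "\<exists>U\<in>systems L \<K>. (\<exists>f. system_embedding L S U f) \<and> (\<exists>f. system_embedding L T U f)"
    using U(1) by blast
qed

lemma JEP_imp_transitive:
  fixes \<K> :: "('f, 'r, 'a) fo_structure set"
  assumes lim: "fraisse_limit L \<K> K" and infin: "infinite (UNIV :: 'a set)"
    and jep: "systems_JEP L \<K>"
  shows "conjugation_transitive L K"
  unfolding conjugation_transitive_def
proof (intro ballI allI impI)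
  let ?G = "Aut L K"
  fix g q X Y
  assume g: "g \<in> carrier ?G" and q: "q \<in> carrier ?G"
    and XY: "finite X \<and> X \<subseteq> univ K \<and> finite Y \<and> Y \<subseteq> univ K"
  have K: "is_structure L K" "locally_finite L K" "ultrahomogeneous L K"
    and mem: "\<And>A. A \<in> \<K> \<longleftrightarrow> finite_structure L A \<and> embeds L A K"
    using lim by (auto simp: fraisse_limit_def)
  interpret group ?G by (rule Aut_group[OF K(1)])
  have part: "\<exists>S e. S \<in> systems L \<K> \<and> realizes L K p S e \<and> Z \<subseteq> e ` univ (src S)"
    if p: "p \<in> carrier ?G" and Z: "finite Z" "Z \<subseteq> univ K" for p Z
  proof -
    obtain E where E: "Z \<subseteq> E" "finite E" "E \<noteq> {}" "closed_subset L K E"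
      by (rule finite_closed_superset[OF K(1,2) Z])
    have "E \<subseteq> univ K" using E(4) by (simp add: closed_subset_def)
    then have "finite (E \<union> p ` E)" "E \<union> p ` E \<subseteq> univ K" using E(2) Aut_closed[OF p] by auto
    then obtain D where D: "E \<union> p ` E \<subseteq> D" "finite D" "closed_subset L K D"
      by (rule finite_closed_superset[OF K(1,2)])
    then have "E \<subseteq> D" "p ` E \<subseteq> D" by auto
    then obtain S i where "S \<in> systems L \<K>" "realizes L K p S i" "i ` univ (amb S) = D"
        "i ` univ (src S) = E"
      by (rule system_of_finite_part[OF lim infin p E(4,3) D(3,2)])
    then show ?thesis using E(1) by blast
  qed
  have fin: "finite_structure L (amb R)" "univ (src R) \<subseteq> univ (amb R)"
    "\<And>b. b \<in> univ (src R) \<Longrightarrow> pmap R b \<in> univ (amb R)" if "R \<in> systems L \<K>" for R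
    using that mem by (auto simp: systems_def substructure_def is_isomorphism_def)
  obtain S e1 where S: "S \<in> systems L \<K>" and e1: "realizes L K g S e1" "X \<subseteq> e1 ` univ (src S)"
    using part[of g X] g XY by blast
  obtain T e2 where T: "T \<in> systems L \<K>" and e2: "realizes L K q T e2" "Y \<subseteq> e2 ` univ (src T)"
    using part[of q Y] q XY by blast
  obtain U f1 f2 where U: "U \<in> systems L \<K>" and f1: "system_embedding L S U f1"
    and f2: "system_embedding L T U f2"
    using jep S T unfolding systems_JEP_def by blast
  obtain u e where u: "u \<in> carrier ?G" and e: "realizes L K u U e"
    using system_realized[OF lim U] .
  \<comment> \<open>Both pieces now have copies in \<open>(K, u)\<close>; an automorphism moves each copy to its original.\<close>
  have move: "\<exists>a\<in>carrier ?G. \<forall>b\<in>univ (src R). a (u ((inv\<^bsub>?G\<^esub> a) (r b))) = p (r b)"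
    if R: "R \<in> systems L \<K>" and r: "realizes L K p R r" and f: "system_embedding L R U f"
    for R r f p
  proof -
    have "is_embedding L (amb R) K (e \<circ> f)"
      using e f embedding_comp by (auto simp: realizes_def system_embedding_def)
    moreover have "is_embedding L (amb R) K r" using r by (simp add: realizes_def)
    ultimately obtain a where a: "a \<in> carrier ?G" "\<And>x. x \<in> univ (amb R) \<Longrightarrow> a ((e \<circ> f) x) = r x"
      using ultrahomogeneous_Aut[OF K(1,3) fin(1)[OF R]] by metis
    have "a (u ((inv\<^bsub>?G\<^esub> a) (r b))) = p (r b)" if b: "b \<in> univ (src R)" for b
    proof -
      have bA: "b \<in> univ (amb R)" using b fin(2)[OF R] by auto
      have fb: "f b \<in> univ (src U)" "f (pmap R b) = pmap U (f b)"
        using f b by (auto simp: system_embedding_def)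
      have ek: "e (f b) \<in> univ K"
        using e fin(2)[OF U] fb(1) by (auto simp: realizes_def is_embedding_def)
      have "(inv\<^bsub>?G\<^esub> a) (r b) = e (f b)"
        using a(2)[OF bA] Aut_inv_apply(1)[OF K(1) a(1) ek] by simp
      moreover have "u (e (f b)) = e (f (pmap R b))"
        using e fb by (simp add: realizes_def)
      moreover have "a (e (f (pmap R b))) = r (pmap R b)"
        using a(2)[OF fin(3)[OF R b]] by simp
      moreover have "r (pmap R b) = p (r b)" using r b by (simp add: realizes_def)
      ultimately show ?thesis by simp
    qed
    with a(1) show ?thesis by blast
  qed
  obtain a where a: "a \<in> carrier ?G"
    and ag: "\<forall>b\<in>univ (src S). a (u ((inv\<^bsub>?G\<^esub> a) (e1 b))) = g (e1 b)"
    using move[OF S e1(1) f1] by blast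
  obtain d where d: "d \<in> carrier ?G"
    and dq: "\<forall>b\<in>univ (src T). d (u ((inv\<^bsub>?G\<^esub> d) (e2 b))) = q (e2 b)"
    using move[OF T e2(1) f2] by blast
  let ?c = "a \<otimes>\<^bsub>?G\<^esub> u \<otimes>\<^bsub>?G\<^esub> inv\<^bsub>?G\<^esub> a" and ?h = "a \<otimes>\<^bsub>?G\<^esub> inv\<^bsub>?G\<^esub> d"
  have app: "?c x = a (u ((inv\<^bsub>?G\<^esub> a) x))" "?h x = a ((inv\<^bsub>?G\<^esub> d) x)" if "x \<in> univ K" for x
  proof -
    have "(inv\<^bsub>?G\<^esub> a) x \<in> univ K" using that a by (simp add: Aut_closed[of _ L])
    then show "?c x = a (u ((inv\<^bsub>?G\<^esub> a) x))" "?h x = a ((inv\<^bsub>?G\<^esub> d) x)"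
      using that a d u by (simp_all add: Aut_mult_apply)
  qed
  have "?c x = g x" if x: "x \<in> X" for x
  proof -
    obtain b where "b \<in> univ (src S)" "x = e1 b" using x e1(2) by auto
    then show ?thesis using ag app(1)[of x] x XY by auto
  qed
  moreover have "?h (q y) = ?c (?h y)" if y: "y \<in> Y" for y
  proof -
    have yK: "y \<in> univ K" using y XY by auto
    obtain b where "b \<in> univ (src T)" "y = e2 b" using y e2(2) by auto
    then have qy: "q y = d (u ((inv\<^bsub>?G\<^esub> d) y))" using dq by simp
    let ?z = "(inv\<^bsub>?G\<^esub> d) y"
    have z: "?z \<in> univ K" using d yK by (simp add: Aut_closed[of _ L])
    have "?h (q y) = a (u ?z)"
      using app(2)[of "q y"] Aut_closed[OF q yK] qy Aut_inv_apply(1)[OF K(1) d] Aut_closed[OF u z]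
      by simp
    also have "\<dots> = ?c (a ?z)"
      using app(1)[of "a ?z"] Aut_closed[OF a z] Aut_inv_apply(1)[OF K(1) a z] by simp
    also have "\<dots> = ?c (?h y)" using app(2)[OF yK] by simp
    finally show ?thesis .
  qed
  ultimately show "\<exists>c\<in>carrier ?G. \<exists>h\<in>carrier ?G.
      (\<forall>x\<in>X. c x = g x) \<and> (\<forall>y\<in>Y. h (q y) = c (h y))"
    using a d u by (intro bexI[of _ ?c] bexI[of _ ?h]) auto
qed

lemma fraisse_class_infinite_type:
  fixes \<K> :: "('f, 'r, 'a) fo_structure set"
  assumes "fraisse_class L \<K>"
  shows "infinite (UNIV :: 'a set)"
proof
  assume fin: "finite (UNIV :: 'a set)"
  obtain A where "A \<in> \<K>" "Suc (card (UNIV :: 'a set)) \<le> card (univ A)"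
    using assms unfolding fraisse_class_def by blast
  then show False using card_mono[OF fin, of "univ A"] by simp
qed

theorem theorem1p1:
  fixes L :: "('f, 'r) signature"
    and \<K> :: "('f, 'r, 'a) fo_structure set"
    and K :: "('f, 'r, 'k) fo_structure"
  assumes "countable_signature L"
    and "fraisse_class L \<K>"
    and "fraisse_limit L \<K> K"
  shows "has_dense_conjugacy_class L K \<longleftrightarrow> systems_JEP L \<K>"
proof -
  have K: "is_structure L K" "countable (univ K)" using assms(3) by (auto simp: fraisse_limit_def)
  have infin: "infinite (UNIV :: 'a set)" by (rule fraisse_class_infinite_type[OF assms(2)])
  have "has_dense_conjugacy_class L K \<longleftrightarrow> conjugation_transitive L K"
    using dense_class_imp_transitive[OF K(1)] transitive_imp_dense_class[OF K] by blast
  also have "\<dots> \<longleftrightarrow> systems_JEP L \<K>"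
    using transitive_imp_JEP[OF assms(3) infin] JEP_imp_transitive[OF assms(3) infin] by blast
  finally show ?thesis .
qed

end
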